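(* Let $L:\mathbb{R}^n\to\mathbb{R}^n$ be a linear operator, let $P:\mathbb{R}^n\to\mathbb{R}^m$ be a linear map of full rank $m$, and let $N=\ker P$. Define subspaces $N_i$ of $\mathbb{R}^n$ by $N_1=N$ and $N_{i+1}=N\cap L(N_i)$ for $i\ge 1$. If there is no nontrivial subspace $G$ of $N$ such that $L(G)\subseteq G$, then for every integer $i$ with $1\le i\le \dim N+1$, $$\dim N_i\le \dim N-i+1 .$$
   Context: "Nontrivial subspace" means a subspace different from $\{0\}$ ($G=N$ is allowed). $L$ is not assumed invertible. Here $L(V)$ denotes the image of a subspace $V$ under $L$. *)

theory Defs
  imports "HOL-Analysis.Analysis"
begin

(* The sequence is indexed from 1; the value at 0 is a dummy and is not used
   by the recursion. *)
fun subspace_seq :: "('a \<Rightarrow> 'a) \<Rightarrow> 'a set \<Rightarrow> nat \<Rightarrow> 'a set" where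
  "subspace_seq L N 0 = N"
| "subspace_seq L N (Suc 0) = N"
| "subspace_seq L N (Suc (Suc i)) = N \<inter> L ` subspace_seq L N (Suc i)"

end

theory Submission imports Defs begin

text \<open>
  The sequence is decreasing, since \<open>V \<mapsto> N \<inter> L(V)\<close> is monotone and sends \<open>N\<close> to a
  subspace of \<open>N\<close>.
  Whenever it fails to drop strictly, \<open>N\<^sub>i = N\<^sub>i\<^sub>+\<^sub>1 \<subseteq> L(N\<^sub>i)\<close>; as a linear map does not raise
  dimension, this inclusion is an equality, so \<open>N\<^sub>i\<close> is an invariant subspace of \<open>N\<close> and
  hence zero (lemma \<open>dim_subspace_seq_Suc_less\<close>). Thus the dimension falls by at least one
  at every step until it reaches \<open>0\<close>, and the bound \<open>dim N - i + 1\<close> remains nonnegative as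
  long as \<open>i \<le> dim N + 1\<close>.
\<close>

lemma subspace_subspace_seq:
  assumes "linear L" and "subspace N"
  shows "subspace (subspace_seq L N i)"
  using assms
  by (induction L N i rule: subspace_seq.induct)
     (auto intro: subspace_inter linear_subspace_image)

lemma subspace_seq_subset: "subspace_seq L N i \<subseteq> N"
  by (induction L N i rule: subspace_seq.induct) auto

lemma subspace_seq_Suc_subset: "subspace_seq L N (Suc i) \<subseteq> subspace_seq L N i"
  by (induction L N i rule: subspace_seq.induct) auto

text \<open>
  A linear map does not raise dimension, so the image of \<open>V\<close> has no room for anything
  beyond \<open>V\<close>. This turns the inclusion that stagnation of the sequence provides into
  the opposite one, which is invariance.
\<close>

lemma linear_image_eq_of_subset_image:
  fixes L :: "'a::euclidean_space \<Rightarrow> 'a"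
  assumes "linear L" and "subspace V" and "V \<subseteq> L ` V"
  shows "L ` V = V"
  using subspace_dim_equal[of V "L ` V"] linear_subspace_image[of L V] dim_image_le[of L V] assms
  by auto

lemma dim_subspace_seq_Suc_less:
  fixes L :: "'a::euclidean_space \<Rightarrow> 'a"
  assumes L: "linear L" and N: "subspace N"
    and no_invariant: "\<And>G. subspace G \<Longrightarrow> G \<subseteq> N \<Longrightarrow> L ` G \<subseteq> G \<Longrightarrow> G = {0}"
    and nonzero: "subspace_seq L N (Suc i) \<noteq> {0}"
  shows "dim (subspace_seq L N (Suc (Suc i))) < dim (subspace_seq L N (Suc i))"
proof (rule ccontr)
  let ?V = "subspace_seq L N (Suc i)"
  assume "\<not> ?thesis"
  then have "subspace_seq L N (Suc (Suc i)) = ?V"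
    by (intro subspace_dim_equal subspace_subspace_seq L N subspace_seq_Suc_subset) simp
  then have "?V \<subseteq> L ` ?V"
    by auto
  then have "L ` ?V = ?V"
    by (intro linear_image_eq_of_subset_image subspace_subspace_seq L N)
  then have "?V = {0}"
    by (intro no_invariant subspace_subspace_seq subspace_seq_subset L N) simp
  with nonzero show False ..
qed

text \<open>
  Truncated subtraction is intended here: once the sequence has reached zero it stays
  there, so the bound holds for every index, which spares the induction a range condition.
\<close>

lemma dim_subspace_seq_Suc_le:
  fixes L :: "'a::euclidean_space \<Rightarrow> 'a"
  assumes L: "linear L" and N: "subspace N"
    and no_invariant: "\<And>G. subspace G \<Longrightarrow> G \<subseteq> N \<Longrightarrow> L ` G \<subseteq> G \<Longrightarrow> G = {0}"
  shows "dim (subspace_seq L N (Suc i)) \<le> dim N - i"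
proof (induction i)
  case 0
  then show ?case by simp
next
  case (Suc i)
  show ?case
  proof (cases "subspace_seq L N (Suc i) = {0}")
    case True
    then have "subspace_seq L N (Suc (Suc i)) \<subseteq> {0}"
      using subspace_seq_Suc_subset[of L N "Suc i"] by simp
    then have "dim (subspace_seq L N (Suc (Suc i))) = 0"
      by (simp only: dim_eq_0)
    then show ?thesis by (simp only: le0)
  next
    case False
    with dim_subspace_seq_Suc_less[OF L N no_invariant] Suc.IH show ?thesis
      by fastforce
  qed
qed

theorem theorem1:
  fixes L :: "real ^ 'n \<Rightarrow> real ^ 'n"
    and P :: "real ^ 'n \<Rightarrow> real ^ 'm"
    and N :: "(real ^ 'n) set"
  assumes "linear L"
    and "linear P"
    and "dim (range P) = CARD('m)"
    and "N = {x. P x = 0}"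
    and "\<not> (\<exists>G. subspace G \<and> G \<noteq> {0} \<and> G \<subseteq> N \<and> L ` G \<subseteq> G)"
  shows "\<forall>i::nat. 1 \<le> i \<and> i \<le> dim N + 1 \<longrightarrow>
           int (dim (subspace_seq L N i)) \<le> int (dim N) - int i + 1"
proof (intro allI impI)
  fix i :: nat
  assume i: "1 \<le> i \<and> i \<le> dim N + 1"
  then obtain j where j: "i = Suc j"
    by (cases i) auto
  have "subspace N"
    using assms(2,4) linear_subspace_kernel by blast
  then have "dim (subspace_seq L N (Suc j)) \<le> dim N - j"
    using assms(1,5) by (intro dim_subspace_seq_Suc_le) auto
  with i j show "int (dim (subspace_seq L N i)) \<le> int (dim N) - int i + 1"
    by simp
qed

end
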